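(* Let $f\colon\mathbb{R}^d\to\mathbb{R}$ be convex and twice differentiable, and let $H>0$ be a constant such that for all $x,y\in\mathbb{R}^d$ $$f(y)\le f(x)+\langle\nabla f(x),y-x\rangle+\tfrac12\langle\nabla^2 f(x)(y-x),y-x\rangle+\tfrac{H}{3}\|y-x\|^3,$$ $$\|\nabla f(y)-\nabla f(x)-\nabla^2 f(x)(y-x)\|\le H\|x-y\|^2.$$ Let $x^0\in\mathbb{R}^d$ and $H_0>0$. Assume that there is $x^*\in\mathbb{R}^d$ with $f(x^* )=f^*:=\min_{x\in\mathbb{R}^d} f(x)$ and a constant $D>0$ such that $\|x-x^*\|\le D$ for every $x$ satisfying $f(x)\le f(x^0)$. Run the algorithm AdaN (described in the context) with inputs $x^0$ and $H_0$, and let $n_k$ denote the number of inner iterations of the line search loop at global iteration $k$, and $N_k=n_0+\dots+n_k$ the total number of computed Newton steps after global iterations $0,\dots,k$. Then $$N_k\le 2(k+1)+\max\left(0,\log_2\frac{2H}{H_0}\right)\qquad\text{for all }k\ge 0,$$ and the iterates satisfy $$f(x^k)-f^*=\mathcal{O}\left(\frac1{k^2}\right)=\mathcal{O}\left(\frac{1}{N_k^2}\right).$$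
   Context: $\|\cdot\|$ is the Euclidean norm on $\mathbb{R}^d$; $\mathbf{I}$ is the identity matrix. The notation $\mathcal{O}(\cdot)$ is the non-asymptotic big-O that hides all constants and keeps only the dependence on the iteration counter: the last conclusion means that there are constants $C,C'$ not depending on $k$ with $f(x^k)-f^*\le C/k^2$ and $f(x^k)-f^*\le C'/N_k^2$ for all $k\ge1$. Algorithm AdaN (adaptive regularized Newton with line search). Inputs: $x^0\in\mathbb{R}^d$, $H_0>0$. Put $\widehat H_{-1}=H_0$. For $k=0,1,2,\dots$: initialize $\widehat H_k=\widehat H_{k-1}/4$ and $n_k=0$; then repeat the following inner iteration: (i) $\widehat H_k\leftarrow 2\widehat H_k$; (ii) $n_k\leftarrow n_k+1$; (iii) $\lambda_k=\sqrt{\widehat H_k\|\nabla f(x^k)\|}$; (iv) $x^+=x^k-(\nabla^2 f(x^k)+\lambda_k\mathbf{I})^{-1}\nabla f(x^k)$ (one "Newton step"); (v) $r_+=\|x^+-x^k\|$; until both $\|\nabla f(x^+)\|\le 2\lambda_k r_+$ and $f(x^+)\le f(x^k)-\frac23\lambda_k r_+^2$ hold. Then set $x^{k+1}=x^+$. The values $\widehat H_k$, $n_k$ and $\lambda_k$ are those at the end of the inner loop. It is assumed that all matrices inverted in (iv) are invertible, so that the algorithm is defined. *)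

theory Defs
  imports "HOL-Analysis.Analysis"
begin

text \<open>
  Throughout, \<open>g\<close> is the gradient of the objective \<open>f\<close>, \<open>A\<close> its Hessian (as a matrix),
  and \<open>h\<close> a value of the smoothness estimate (written H-hat in the algorithm).
\<close>

definition reg_param :: "(real^'d \<Rightarrow> real^'d) \<Rightarrow> real \<Rightarrow> real^'d \<Rightarrow> real" where
  "reg_param g h x = sqrt (h * norm (g x))"

definition reg_hessian ::
  "(real^'d \<Rightarrow> real^'d) \<Rightarrow> (real^'d \<Rightarrow> real^'d^'d) \<Rightarrow> real \<Rightarrow> real^'d \<Rightarrow> real^'d^'d" where
  "reg_hessian g A h x = A x + reg_param g h x *\<^sub>R mat 1"

definition newton_step ::
  "(real^'d \<Rightarrow> real^'d) \<Rightarrow> (real^'d \<Rightarrow> real^'d^'d) \<Rightarrow> real \<Rightarrow> real^'d \<Rightarrow> real^'d" where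
  "newton_step g A h x = x - matrix_inv (reg_hessian g A h x) *v g x"

definition accepted ::
  "(real^'d \<Rightarrow> real) \<Rightarrow> (real^'d \<Rightarrow> real^'d) \<Rightarrow> (real^'d \<Rightarrow> real^'d^'d) \<Rightarrow>
   real^'d \<Rightarrow> real \<Rightarrow> bool" where
  "accepted f g A x h \<longleftrightarrow>
     (let l = reg_param g h x; xp = newton_step g A h x; r = norm (xp - x)
      in norm (g xp) \<le> 2 * l * r \<and> f xp \<le> f x - 2/3 * l * r\<^sup>2)"

text \<open>
  The inner loop at the point \<open>x\<close>, where \<open>hp\<close> is the estimate left by the previous global
  iteration.  The pair \<open>(h, n)\<close> belongs to this set iff the loop body is executed an \<open>n\<close>-th
  time, with \<open>h\<close> being the estimate after the doubling in that pass.  The loop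
  may a priori run forever, in which case the set is infinite.
\<close>

inductive_set inner_passes ::
  "(real^'d \<Rightarrow> real) \<Rightarrow> (real^'d \<Rightarrow> real^'d) \<Rightarrow> (real^'d \<Rightarrow> real^'d^'d) \<Rightarrow>
   real^'d \<Rightarrow> real \<Rightarrow> (real \<times> nat) set"
  for f :: "real^'d \<Rightarrow> real" and g A x hp where
  first: "(2 * (hp / 4), 1) \<in> inner_passes f g A x hp"
| again: "(h, n) \<in> inner_passes f g A x hp \<Longrightarrow> \<not> accepted f g A x h \<Longrightarrow>
    (2 * h, n + 1) \<in> inner_passes f g A x hp"

text \<open>
  The final estimate and the number of passes; \<open>None\<close> if the loop does not terminate.  At
  most one pass is accepted, because an accepted pass is the last one.
\<close>

definition line_search ::
  "(real^'d \<Rightarrow> real) \<Rightarrow> (real^'d \<Rightarrow> real^'d) \<Rightarrow> (real^'d \<Rightarrow> real^'d^'d) \<Rightarrow>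
   real^'d \<Rightarrow> real \<Rightarrow> (real \<times> nat) option" where
  "line_search f g A x hp =
     (if \<exists>s \<in> inner_passes f g A x hp. accepted f g A x (fst s)
      then Some (THE s. s \<in> inner_passes f g A x hp \<and> accepted f g A x (fst s))
      else None)"

text \<open>
  The state at the beginning of global iteration \<open>k\<close>: the iterate with index \<open>k\<close> and the
  estimate with index \<open>k - 1\<close> (which is \<open>H0\<close> for \<open>k = 0\<close>); \<open>None\<close> if that iteration is never
  reached.
\<close>

primrec adan ::
  "(real^'d \<Rightarrow> real) \<Rightarrow> (real^'d \<Rightarrow> real^'d) \<Rightarrow> (real^'d \<Rightarrow> real^'d^'d) \<Rightarrow>
   real^'d \<Rightarrow> real \<Rightarrow> nat \<Rightarrow> ((real^'d) \<times> real) option" where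
  "adan f g A x0 H0 0 = Some (x0, H0)"
| "adan f g A x0 H0 (Suc k) =
     Option.bind (adan f g A x0 H0 k) (\<lambda>(x, hp).
       map_option (\<lambda>(h, n). (newton_step g A h x, h)) (line_search f g A x hp))"

end

theory Submission
  imports Defs
begin

text \<open>
  Write \<open>s\<close> for a Newton step, so that \<open>A s + l s = - g\<close>.  Since the Hessian is positive
  semidefinite, \<open>l * norm s \<le> norm g\<close>; for an estimate \<open>h \<ge> H\<close> this gives \<open>H * norm s \<le> l\<close>, and
  the two smoothness bounds then yield acceptance.  Hence all estimates stay below
  \<open>max H0 (2 * H)\<close>, and as \<open>n\<close> passes multiply the estimate by \<open>2 ^ n / 4\<close>, the number of Newton
  steps is read off the last estimate.

  For the rate, call a step good if the gradient norm drops at most by the factor 4.  A good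
  step decreases the gap by at least a multiple of \<open>a powr (3/2)\<close>, where \<open>a\<close> is the gap after
  the step, so \<open>m\<close> good steps force the gap to be \<open>O(1/m\<^sup>2)\<close>.  A gradient norm at most doubles in
  any step, so if at most a third of the first \<open>k\<close> steps are good, the gradient has decreased by
  the factor \<open>2 ^ k\<close>, and convexity on the bounded sublevel set transfers this to the gap.
\<close>

section \<open>Matrix inverses, and convex functions with their first two derivatives\<close>

lemma matrix_inv_right:
  fixes M :: "'a::semiring_1^'n^'m"
  assumes "invertible M"
  shows "M ** matrix_inv M = mat 1"
proof -
  have "\<exists>M'. M ** M' = mat 1 \<and> M' ** M = mat 1"
    using assms by (simp add: invertible_def)
  then show ?thesis
    unfolding matrix_inv_def by (rule someI2_ex) simp
qed

text \<open>Restricting \<open>f\<close> to the line through \<open>x\<close> and \<open>y\<close>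
  reduces this to the tangent inequality for convex functions of one real variable, used between 0
  and 1.\<close>

lemma convex_on_above_gradient:
  fixes f :: "'a::euclidean_space \<Rightarrow> real"
  assumes "convex_on UNIV f" and "GDERIV f x :> G"
  shows "f x + G \<bullet> (y - x) \<le> f y"
proof -
  define \<phi> where "\<phi> t = f (x + t *\<^sub>R (y - x))" for t
  have conv: "convex_on UNIV \<phi>"
  proof (rule convex_onI)
    fix t a b :: real
    assume "0 < t" "t < 1"
    then have "f ((1 - t) *\<^sub>R (x + a *\<^sub>R (y - x)) + t *\<^sub>R (x + b *\<^sub>R (y - x)))
        \<le> (1 - t) * \<phi> a + t * \<phi> b"
      unfolding \<phi>_def by (intro convex_onD[OF assms(1)]) auto
    then show "\<phi> ((1 - t) *\<^sub>R a + t *\<^sub>R b) \<le> (1 - t) * \<phi> a + t * \<phi> b"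
      by (simp add: \<phi>_def algebra_simps)
  qed simp
  have "((\<lambda>t. x + t *\<^sub>R (y - x)) has_derivative (\<lambda>t. t *\<^sub>R (y - x))) (at (0::real))"
    by (auto intro!: derivative_eq_intros)
  moreover have "(f has_derivative (\<lambda>h. h \<bullet> G)) (at (x + 0 *\<^sub>R (y - x)))"
    using assms(2) by (simp add: gderiv_def)
  ultimately have "((\<lambda>t. f (x + t *\<^sub>R (y - x))) has_derivative (\<lambda>t. t *\<^sub>R (y - x) \<bullet> G)) (at 0)"
    by (rule has_derivative_compose)
  then have "(\<phi> has_field_derivative (G \<bullet> (y - x))) (at 0)"
    unfolding \<phi>_def has_field_derivative_def
    by (simp add: inner_commute[of _ G] mult_commute_abs)
  then have "(G \<bullet> (y - x)) * (1 - 0) \<le> \<phi> 1 - \<phi> 0"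
    by (intro convex_on_imp_above_tangent[OF conv]) auto
  then show ?thesis by (simp add: \<phi>_def)
qed

lemma convex_gradient_monotone:
  fixes f :: "'a::euclidean_space \<Rightarrow> real"
  assumes "convex_on UNIV f" and "\<And>x. GDERIV f x :> g x"
  shows "0 \<le> (g y - g x) \<bullet> (y - x)"
  using convex_on_above_gradient[OF assms(1) assms(2)[of x], of y]
    convex_on_above_gradient[OF assms(1) assms(2)[of y], of x]
  by (simp add: algebra_simps)

text \<open>The number \<open>g' v \<bullet> v\<close> is the slope at 0 of
  \<open>g (x + t *\<^sub>R v) \<bullet> v\<close> in \<open>t\<close>; a negative slope would make
  this function drop to the right of 0, against monotonicity. Applied to the gradient, it makes the
  Hessian positive semidefinite.\<close>

lemma monotone_derivative_nonneg:
  fixes g :: "'a::real_inner \<Rightarrow> 'a"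
  assumes deriv: "(g has_derivative g') (at x)"
    and mono: "\<And>y. 0 \<le> (g y - g x) \<bullet> (y - x)"
  shows "0 \<le> g' v \<bullet> v"
proof -
  define \<psi> where "\<psi> t = g (x + t *\<^sub>R v) \<bullet> v" for t
  have "((\<lambda>t. x + t *\<^sub>R v) has_derivative (\<lambda>t. t *\<^sub>R v)) (at (0::real))"
    by (auto intro!: derivative_eq_intros)
  moreover have "(g has_derivative g') (at (x + 0 *\<^sub>R v))"
    using deriv by simp
  ultimately have "((\<lambda>t. g (x + t *\<^sub>R v)) has_derivative (\<lambda>t. g' (t *\<^sub>R v))) (at 0)"
    by (rule has_derivative_compose)
  then have "(\<psi> has_derivative (\<lambda>t. g' (t *\<^sub>R v) \<bullet> v)) (at 0)"
    unfolding \<psi>_def by (rule has_derivative_inner_left)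
  moreover have "g' (t *\<^sub>R v) = t *\<^sub>R g' v" for t
    using deriv by (simp add: has_derivative_linear linear_scale)
  ultimately have d: "(\<psi> has_field_derivative g' v \<bullet> v) (at 0)"
    by (simp add: has_field_derivative_def mult_commute_abs)
  show ?thesis
  proof (rule ccontr)
    assume "\<not> 0 \<le> g' v \<bullet> v"
    then obtain e where e: "e > 0" "\<And>t. 0 < t \<Longrightarrow> t < e \<Longrightarrow> \<psi> (0 + t) < \<psi> 0"
      using DERIV_neg_dec_right[OF d] by auto
    have "\<psi> (e/2) < \<psi> 0"
      using e(2)[of "e/2"] e(1) by simp
    moreover have "0 \<le> (e/2) * (\<psi> (e/2) - \<psi> 0)"
      using mono[of "x + (e/2) *\<^sub>R v"] by (simp add: \<psi>_def inner_diff_left)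
    ultimately show False
      using e(1) by (simp add: zero_le_mult_iff)
  qed
qed

section \<open>The regularized Newton step and its acceptance\<close>

lemma newton_step_system:
  assumes "invertible (reg_hessian g A h x)"
  shows "A x *v (newton_step g A h x - x) + reg_param g h x *\<^sub>R (newton_step g A h x - x) = - g x"
proof -
  have "reg_hessian g A h x *v (newton_step g A h x - x)
      = - ((reg_hessian g A h x ** matrix_inv (reg_hessian g A h x)) *v g x)"
    by (simp add: newton_step_def matrix_vector_mul_assoc[symmetric] vec.neg)
  also have "\<dots> = - g x"
    by (simp add: matrix_inv_right[OF assms])
  finally show ?thesis
    by (simp add: reg_hessian_def matrix_vector_mult_add_rdistrib
        scaleR_matrix_vector_assoc[symmetric])
qed

text \<open>In the inner product of the linear system with the step, the Hessian term has a sign and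
  Cauchy-Schwarz bounds the gradient term. The bound serves twice: for acceptance at large
  estimates, and for the gradient norm at most doubling.\<close>

lemma newton_step_displacement:
  assumes "h > 0" and "invertible (reg_hessian g A h x)" and psd: "\<And>v. 0 \<le> (A x *v v) \<bullet> v"
  shows "reg_param g h x * norm (newton_step g A h x - x) \<le> norm (g x)"
proof -
  define s l where "s = newton_step g A h x - x" and "l = reg_param g h x"
  have "(A x *v s) \<bullet> s + l * (s \<bullet> s) = - g x \<bullet> s"
    using arg_cong[OF newton_step_system[OF assms(2)], of "\<lambda>v. v \<bullet> s"]
    by (simp add: s_def l_def inner_add_left)
  then have "l * (s \<bullet> s) \<le> - g x \<bullet> s"
    using psd[of s] by simp
  also have "\<dots> \<le> norm (g x) * norm s"
    using norm_cauchy_schwarz[of "- g x" s] by simp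
  finally have "(l * norm s) * norm s \<le> norm (g x) * norm s"
    by (simp add: dot_square_norm power2_eq_square mult.assoc)
  then have "l * norm s \<le> norm (g x)" if "s \<noteq> 0"
    using that by simp
  then show ?thesis
    by (cases "s = 0") (auto simp: s_def l_def)
qed

text \<open>Once \<open>H * r \<le> l\<close>, the Taylor errors \<open>H * r\<^sup>2\<close> and
  \<open>H/3 * r ^ 3\<close> are at most \<open>l * r\<close> and
  \<open>1/3 * l * r\<^sup>2\<close>. Added to the exact contributions \<open>l * r\<close> and
  \<open>- l * r\<^sup>2\<close> of the linear system, they give the constants 2 and 2/3 of the
  test.\<close>

lemma accepted_if_estimate_ge:
  assumes "H > 0" and "H \<le> h" and inv: "invertible (reg_hessian g A h x)"
    and psd: "\<And>v. 0 \<le> (A x *v v) \<bullet> v"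
    and cubic: "\<And>y. f y \<le> f x + g x \<bullet> (y - x) + 1/2 * ((A x *v (y - x)) \<bullet> (y - x))
                  + H/3 * norm (y - x) ^ 3"
    and gb: "\<And>y. norm (g y - g x - A x *v (y - x)) \<le> H * (norm (x - y))\<^sup>2"
  shows "accepted f g A x h"
proof -
  define xp s l r where "xp = newton_step g A h x" and "s = xp - x" and "l = reg_param g h x"
    and "r = norm s"
  have l0: "l \<ge> 0" and r0: "r \<ge> 0"
    using assms(1,2) by (auto simp: l_def r_def reg_param_def)
  have l2: "l\<^sup>2 = h * norm (g x)"
    using assms(1,2) by (simp add: l_def reg_param_def)
  have sys: "A x *v s + l *\<^sub>R s = - g x"
    using newton_step_system[OF inv] by (simp add: xp_def s_def l_def)
  have lr: "l * r \<le> norm (g x)"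
    using newton_step_displacement[of h g A x] assms by (simp add: l_def r_def s_def xp_def)
  have Hr: "H * r \<le> l"
  proof (cases "l = 0")
    \<comment> \<open>Here \<open>x\<close> is stationary and the step vanishes, while the other
      case divides by \<open>l\<close>.\<close>
    case True
    then have "norm (g x) = 0" using l2 assms(1,2) by auto
    then have "newton_step g A h x = x" by (simp add: newton_step_def)
    then show ?thesis using l0 by (simp add: r_def s_def xp_def)
  next
    case False
    have "(H * r) * l = H * (l * r)" by simp
    also have "\<dots> \<le> h * norm (g x)"
      using lr assms(1,2) r0 l0 by (intro mult_mono) auto
    also have "\<dots> = l * l" using l2 by (simp add: power2_eq_square)
    finally show ?thesis using False l0 by simp
  qed
  have "norm (g xp) = norm ((g xp - g x - A x *v s) - l *\<^sub>R s)"
    using arg_cong[OF sys, of "\<lambda>v. v + g x"] by (simp add: algebra_simps)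
  also have "\<dots> \<le> norm (g xp - g x - A x *v s) + norm (l *\<^sub>R s)"
    by (rule norm_triangle_ineq4)
  also have "\<dots> \<le> H * r\<^sup>2 + l * r"
    using gb[of xp] l0 by (simp add: s_def r_def norm_minus_commute)
  also have "\<dots> \<le> 2 * l * r"
    using mult_right_mono[OF Hr r0] by (simp add: power2_eq_square algebra_simps)
  finally have "norm (g xp) \<le> 2 * l * r" .
  moreover have "f xp \<le> f x - 2/3 * l * r\<^sup>2"
  proof -
    have "(A x *v s) \<bullet> s + l * r\<^sup>2 = - (g x \<bullet> s)"
      using arg_cong[OF sys, of "\<lambda>v. v \<bullet> s"]
      by (simp add: inner_add_left r_def power2_norm_eq_inner)
    moreover have "H/3 * r ^ 3 \<le> 1/3 * l * r\<^sup>2"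
      using mult_right_mono[OF Hr, of "r\<^sup>2"] by (simp add: power2_eq_square power3_eq_cube mult.assoc)
    ultimately show ?thesis
      using cubic[of xp] psd[of s] by (simp add: s_def[symmetric] r_def[symmetric])
  qed
  ultimately show ?thesis
    by (simp add: accepted_def Let_def xp_def l_def r_def s_def)
qed

section \<open>The line search loop\<close>

text \<open>The loop only doubles the estimate, so the pass number determines it, and the rejection
  of all earlier passes is the only further condition. Questions about the loop thus become
  questions about \<open>n\<close>.\<close>

lemma inner_passes_iff:
  "(h, n) \<in> inner_passes f g A x hp \<longleftrightarrow>
     1 \<le> n \<and> h = hp / 4 * 2 ^ n \<and> (\<forall>m\<in>{1..<n}. \<not> accepted f g A x (hp / 4 * 2 ^ m))"
  (is "?L h n \<longleftrightarrow> ?R h n")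
proof
  show "?R h n" if "?L h n"
    using that
  proof induction
    case (again h n)
    then have h: "h = hp / 4 * 2 ^ n" and "{1..<n + 1} = insert n {1..<n}" by auto
    with again show ?case unfolding h by simp
  qed simp
  have "?R h n \<Longrightarrow> ?L h n" for h
  proof (induction n arbitrary: h)
    case (Suc n)
    show ?case
    proof (cases "n = 0")
      case True
      then have "h = 2 * (hp / 4)" "Suc n = 1"
        using Suc.prems by auto
      then show ?thesis
        by (simp only: inner_passes.first)
    next
      case False
      then have "(hp / 4 * 2 ^ n, n) \<in> inner_passes f g A x hp"
          "\<not> accepted f g A x (hp / 4 * 2 ^ n)"
        using Suc by auto
      from inner_passes.again[OF this] have "(2 * (hp / 4 * 2 ^ n), Suc n) \<in> inner_passes f g A x hp"
        by (simp only: Suc_eq_plus1)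
      moreover have "h = 2 * (hp / 4 * 2 ^ n)"
        using Suc.prems by simp
      ultimately show ?thesis by (simp only:)
    qed
  qed simp
  then show "?R h n \<Longrightarrow> ?L h n" .
qed

text \<open>Of two accepted passes with different numbers, the later one could be reached only if
  the earlier one had been rejected.\<close>

lemma inner_passes_accepted_unique:
  assumes "s \<in> inner_passes f g A x hp" "accepted f g A x (fst s)"
    and "t \<in> inner_passes f g A x hp" "accepted f g A x (fst t)"
  shows "s = t"
proof -
  obtain h n where s: "s = (h, n)" by force
  obtain h' n' where t: "t = (h', n')" by force
  have "n = n'"
    using assms unfolding s t inner_passes_iff
    by (metis atLeastLessThan_iff fst_conv linorder_neqE_nat)
  then show ?thesis
    using assms by (simp add: s t inner_passes_iff)
qed

lemma line_search_eq_Some_iff: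
  "line_search f g A x hp = Some s \<longleftrightarrow> s \<in> inner_passes f g A x hp \<and> accepted f g A x (fst s)"
proof
  assume "line_search f g A x hp = Some s"
  then obtain t where t: "t \<in> inner_passes f g A x hp" "accepted f g A x (fst t)"
    and s: "s = (THE s. s \<in> inner_passes f g A x hp \<and> accepted f g A x (fst s))"
    by (auto simp: line_search_def split: if_splits)
  have "s = t"
    unfolding s using t by (blast intro: inner_passes_accepted_unique)
  with t show "s \<in> inner_passes f g A x hp \<and> accepted f g A x (fst s)" by simp
next
  assume "s \<in> inner_passes f g A x hp \<and> accepted f g A x (fst s)"
  then show "line_search f g A x hp = Some s"
    unfolding line_search_def by (auto intro!: the_equality intro: inner_passes_accepted_unique)
qed

text \<open>Doubling eventually lifts the estimate to \<open>H\<close>, so some pass is accepted. If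
  the least accepted pass is not the first, its predecessor was rejected with an estimate below
  \<open>H\<close>, whence the bound \<open>2 * H\<close>. The premise \<open>acc\<close> is
  restricted to passes that occur, because invertibility is assumed only for those.\<close>

lemma line_search_terminates:
  assumes "H > 0" "hp > 0"
    and acc: "\<And>h n. (h, n) \<in> inner_passes f g A x hp \<Longrightarrow> H \<le> h \<Longrightarrow> accepted f g A x h"
  obtains n where "line_search f g A x hp = Some (hp / 4 * 2 ^ n, n)" "1 \<le> n"
    "hp / 4 * 2 ^ n \<le> max hp (2 * H)"
proof -
  define P where "P n \<longleftrightarrow> 1 \<le> n \<and> accepted f g A x (hp / 4 * 2 ^ n)" for n
  define n where "n = (LEAST n. P n)"
  have ex: "\<exists>n. P n"
  proof (rule ccontr)
    assume none: "\<not> (\<exists>n. P n)"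
    obtain m where m: "H / (hp / 4) < 2 ^ m"
      using real_arch_pow[of 2] by auto
    \<comment> \<open>Passes are numbered from 1, so \<open>Suc m\<close> is used in place of a
      possibly vanishing \<open>m\<close>.\<close>
    have "(2::real) ^ m \<le> 2 ^ Suc m" by simp
    with m have "H / (hp / 4) \<le> 2 ^ Suc m" by linarith
    then have "H \<le> hp / 4 * 2 ^ Suc m"
      using assms(2) by (simp add: field_simps)
    moreover have "(hp / 4 * 2 ^ Suc m, Suc m) \<in> inner_passes f g A x hp"
      using none by (auto simp: inner_passes_iff P_def)
    ultimately have "P (Suc m)" using acc by (simp add: P_def)
    with none show False by blast
  qed
  then have Pn: "P n" unfolding n_def by (rule LeastI_ex)
  have least: "\<not> accepted f g A x (hp / 4 * 2 ^ m)" if "1 \<le> m" "m < n" for m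
    using that not_less_Least[of m P] by (auto simp: n_def P_def)
  have "line_search f g A x hp = Some (hp / 4 * 2 ^ n, n)"
    using Pn least by (auto simp: line_search_eq_Some_iff inner_passes_iff P_def)
  moreover have "1 \<le> n" using Pn by (simp add: P_def)
  moreover have "hp / 4 * 2 ^ n \<le> max hp (2 * H)"
  proof (cases "n = 1")
    case True
    then show ?thesis using assms by simp
  next
    case False
    then obtain m where m: "n = Suc m" "1 \<le> m"
      using \<open>1 \<le> n\<close> by (cases n) auto
    then have "(hp / 4 * 2 ^ m, m) \<in> inner_passes f g A x hp"
      using least by (auto simp: inner_passes_iff)
    then have "hp / 4 * 2 ^ m < H"
      using acc least[of m] m by force
    then show ?thesis by (simp add: m)
  qed
  ultimately show ?thesis using that by blast
qed

section \<open>Real sequences: cubic decrease and the counting of good steps\<close>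

text \<open>Induction step for the invariant \<open>s * m \<le> K\<close>: \<open>s\<close> and
  \<open>t\<close> are the square roots of the gap before and after a good step, and
  \<open>m\<close> counts the earlier good steps. A violation would give
  \<open>6 * m\<^sup>2 < (2 * m + 1) * (m + 1)\<close>, false for \<open>m \<ge> 1\<close>; the
  constant 6 makes both sides equal at \<open>m = 1\<close>. The case \<open>m = 0\<close> is
  covered by \<open>t \<le> K\<close>.\<close>

lemma cubic_decrease_step:
  fixes s t c K m :: real
  assumes "c > 0" "0 \<le> t" "0 \<le> s" "m = 0 \<or> 1 \<le> m" and dec: "t\<^sup>2 + c * t ^ 3 \<le> s\<^sup>2"
    and "s * m \<le> K" "t \<le> K" "6 \<le> c * K"
  shows "t * (m + 1) \<le> K"
proof (rule ccontr)
  assume "\<not> ?thesis"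
  then have K: "K < t * (m + 1)" by simp
  then have m: "1 \<le> m" using assms by auto
  have K0: "0 < K" using assms(1,8) by (metis less_le_trans zero_less_mult_pos zero_less_numeral)
  have t0: "0 < t"
    using K K0 m assms(2) by (cases "t = 0") auto
  have "(t\<^sup>2 + c * t ^ 3) * m\<^sup>2 \<le> s\<^sup>2 * m\<^sup>2"
    using dec by (intro mult_right_mono) auto
  also have "\<dots> \<le> K\<^sup>2"
    using power_mono[OF assms(6), of 2] assms m by (simp add: power_mult_distrib)
  also have "\<dots> < (t * (m + 1))\<^sup>2"
    using K K0 by (intro power_strict_mono) auto
  finally have "t\<^sup>2 * (m\<^sup>2 * (1 + c * t)) < t\<^sup>2 * (m + 1)\<^sup>2"
    by (simp add: power2_eq_square power3_eq_cube algebra_simps)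
  then have "m\<^sup>2 * (1 + c * t) < (m + 1)\<^sup>2"
    using t0 by (simp add: mult_less_cancel_left_pos)
  then have "m\<^sup>2 * (c * t) < 2 * m + 1"
    by (simp add: power2_eq_square algebra_simps)
  then have "(m\<^sup>2 * (c * t)) * (m + 1) < (2 * m + 1) * (m + 1)"
    using m by (intro mult_strict_right_mono) auto
  moreover have "m\<^sup>2 * 6 \<le> m\<^sup>2 * (c * (t * (m + 1)))"
    using assms(8) mult_strict_left_mono[OF K assms(1)] by (intro mult_left_mono) auto
  ultimately have "6 * m\<^sup>2 < 2 * m\<^sup>2 + 3 * m + 1"
    by (simp add: power2_eq_square algebra_simps)
  moreover have "1 \<le> m\<^sup>2" "m \<le> m\<^sup>2"
    using m by (auto simp: power2_eq_square mult_le_cancel_left1 intro: order_trans[OF m])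
  ultimately show False by linarith
qed

text \<open>The factor 2 accommodates \<open>k = 3\<close>, the one exponent at which the square
  exceeds the power of 2.\<close>

lemma square_le_two_power: "(real k)\<^sup>2 \<le> 2 * 2 ^ k"
proof (induction k rule: less_induct)
  case (less k)
  show ?case
  proof (cases "k < 4")
    case True
    then consider "k = 0" | "k = 1" | "k = 2" | "k = 3" by linarith
    then show ?thesis by cases auto
  next
    case False
    then obtain j where j: "k = Suc j" "3 \<le> j" by (cases k) auto
    have "3 * real j \<le> (real j)\<^sup>2"
      using j by (simp add: power2_eq_square mult_right_mono)
    moreover have "(real k)\<^sup>2 = (real j)\<^sup>2 + 2 * real j + 1"
      by (simp add: j power2_eq_square algebra_simps)
    ultimately have "(real k)\<^sup>2 \<le> 2 * (real j)\<^sup>2"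
      using j by linarith
    with less[of j] j show ?thesis by simp
  qed
qed

text \<open>The counting argument apart from the algorithm, with \<open>a\<close> as the gap and
  \<open>G\<close> as the gradient norm. Bad steps cannot harm the bound on
  \<open>sqrt (a k) * m k\<close> since \<open>a\<close> is nonincreasing; good steps cost the
  geometric decrease of \<open>G\<close> only a bounded factor each.\<close>

lemma inverse_square_rate:
  fixes a G :: "nat \<Rightarrow> real"
  assumes "c > 0" "D > 0" and a0: "\<And>k. 0 \<le> a k" and aG: "\<And>k. a k \<le> D * G k"
    and a_mono: "\<And>k. a (Suc k) \<le> a k" and G_double: "\<And>k. G (Suc k) \<le> 2 * G k"
    and dec: "\<And>k. G k / 4 \<le> G (Suc k) \<Longrightarrow> a (Suc k) + c * sqrt (a (Suc k)) ^ 3 \<le> a k"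
  shows "\<exists>C\<ge>0. \<forall>k\<ge>1. a k \<le> C / (real k)\<^sup>2"
proof -
  define m where "m k = (\<Sum>i<k. if G i / 4 \<le> G (Suc i) then 1 else 0 :: nat)" for k
  have m_Suc: "m (Suc k) = m k + (if G k / 4 \<le> G (Suc k) then 1 else 0)" for k
    by (simp add: m_def)
  have G0: "0 \<le> G k" for k
    using order_trans[OF a0 aG, of k] assms(2) by (simp add: zero_le_mult_iff)
  \<comment> \<open>The entries provide the premises \<open>6 \<le> c * K\<close> and
    \<open>t \<le> K\<close> of \<open>cubic_decrease_step\<close>.\<close>
  define K where "K = max (6 / c) (sqrt (a 0))"
  have cK: "6 \<le> c * K"
    using assms(1) by (simp add: K_def max_def field_simps)
  have a_le: "sqrt (a k) \<le> K" for k
  proof -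
    have "a k \<le> a 0" by (rule lift_Suc_antimono_le[of a]) (use a_mono in auto)
    then show ?thesis by (simp add: K_def le_max_iff_disj)
  qed
  have sub: "sqrt (a k) * real (m k) \<le> K" for k
  proof (induction k)
    case 0
    then show ?case using assms(1) by (simp add: m_def K_def le_max_iff_disj)
  next
    case (Suc k)
    show ?case
    proof (cases "G k / 4 \<le> G (Suc k)")
      case True
      have "sqrt (a (Suc k)) * (real (m k) + 1) \<le> K"
        using Suc dec[OF True] a0 a_le assms(1) cK
        by (intro cubic_decrease_step[where s = "sqrt (a k)" and c = c]) auto
      with True show ?thesis by (simp add: m_Suc add.commute)
    next
      case False
      have "sqrt (a (Suc k)) * real (m k) \<le> sqrt (a k) * real (m k)"
        using a_mono by (intro mult_right_mono) auto
      with Suc False show ?thesis by (simp add: m_Suc)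
    qed
  qed
  \<comment> \<open>A good step multiplies \<open>G\<close> by at most 2, a bad one by less than
    1/4; after scaling by \<open>4 ^ k\<close> these factors become 8 and 1.\<close>
  have grad: "G k * 4 ^ k \<le> G 0 * 8 ^ m k" for k
  proof (induction k)
    case 0
    then show ?case by (simp add: m_def)
  next
    case (Suc k)
    show ?case
    proof (cases "G k / 4 \<le> G (Suc k)")
      case True
      have "G (Suc k) * 4 ^ Suc k \<le> (2 * G k) * 4 ^ Suc k"
        using G_double by (intro mult_right_mono) auto
      also have "\<dots> = 8 * (G k * 4 ^ k)" by simp
      also have "\<dots> \<le> 8 * (G 0 * 8 ^ m k)" using Suc by simp
      finally show ?thesis using True by (simp add: m_Suc)
    next
      case False
      have "G (Suc k) * 4 ^ Suc k \<le> (G k / 4) * 4 ^ Suc k"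
        using False by (intro mult_right_mono) auto
      also have "\<dots> = G k * 4 ^ k" by simp
      also note Suc
      finally show ?thesis using False by (simp add: m_Suc)
    qed
  qed
  \<comment> \<open>The two entries cover at most and more than \<open>k/3\<close> good steps, respectively.\<close>
  define C where "C = max (2 * D * G 0) (9 * K\<^sup>2)"
  have "a k \<le> C / (real k)\<^sup>2" if "k \<ge> 1" for k
  proof -
    have "a k * (real k)\<^sup>2 \<le> C"
    proof (cases "3 * m k \<le> k")
      case True
      \<comment> \<open>The threshold of a third comes from \<open>8 = 2 ^ 3\<close>: half of the
        decrease \<open>4 ^ k = 2 ^ k * 2 ^ k\<close> survives in the exponent.\<close>
      have "(8::real) ^ m k = 2 ^ (3 * m k)" by (simp add: power_mult)
      also have "\<dots> \<le> 2 ^ k" using True by (intro power_increasing) auto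
      finally have "G 0 * 8 ^ m k \<le> G 0 * 2 ^ k"
        using G0 by (intro mult_left_mono) auto
      with grad[of k] have "(G k * 2 ^ k) * 2 ^ k \<le> G 0 * 2 ^ k"
        by (simp add: mult.assoc flip: power_mult_distrib)
      then have "G k * 2 ^ k \<le> G 0" by simp
      have "a k * (real k)\<^sup>2 \<le> (D * G k) * (2 * 2 ^ k)"
        using aG[of k] a0[of k] square_le_two_power[of k] by (intro mult_mono) auto
      also have "\<dots> = 2 * D * (G k * 2 ^ k)" by simp
      also have "\<dots> \<le> 2 * D * G 0"
        using \<open>G k * 2 ^ k \<le> G 0\<close> assms(2) by (intro mult_left_mono) auto
      finally show ?thesis by (simp add: C_def)
    next
      case False
      have "sqrt (a k) * real k \<le> 3 * (sqrt (a k) * real (m k))"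
        using False a0 mult_left_mono[of "real k" "3 * real (m k)" "sqrt (a k)"] by simp
      also have "\<dots> \<le> 3 * K" using sub by simp
      finally have "(sqrt (a k) * real k)\<^sup>2 \<le> (3 * K)\<^sup>2"
        using a0 by (intro power_mono) auto
      then show ?thesis using a0 by (simp add: power_mult_distrib C_def)
    qed
    then show ?thesis using that by (simp add: field_simps)
  qed
  moreover have "0 \<le> C" by (simp add: C_def le_max_iff_disj)
  ultimately show ?thesis by blast
qed

section \<open>Decrease of the objective in a good step\<close>

text \<open>Squaring the gradient test and inserting the decrease test eliminates \<open>r\<close>
  and gives \<open>w ^ 4 \<le> 6 * l * \<Delta>\<close> with \<open>w = sqrt (norm (g xp))\<close>.
  Goodness bounds \<open>l\<close> by \<open>2 * sqrt M * w\<close>, so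
  \<open>w ^ 3 \<le> 12 * sqrt M * \<Delta>\<close>, and the gap is at most
  \<open>D * w\<^sup>2\<close>. The exponent 3/2 is written as the cube of a root to fit
  \<open>cubic_decrease_step\<close>.\<close>

lemma accepted_decrease:
  assumes acc: "accepted f g A x h" and "0 < h" "h \<le> M" "D > 0"
    and xp: "xp = newton_step g A h x"
    and good: "norm (g x) / 4 \<le> norm (g xp)"
    and gap: "0 \<le> f xp - fs" "f xp - fs \<le> D * norm (g xp)"
  shows "f xp - fs + 1 / (12 * sqrt M * sqrt D ^ 3) * sqrt (f xp - fs) ^ 3 \<le> f x - fs"
proof -
  define l r w \<Delta> where "l = reg_param g h x" and "r = norm (xp - x)"
    and "w = sqrt (norm (g xp))" and "\<Delta> = f x - f xp"
  have w0: "0 \<le> w" and w2: "w\<^sup>2 = norm (g xp)" by (auto simp: w_def)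
  have l0: "0 \<le> l" using assms(2) by (simp add: l_def reg_param_def)
  have sM: "sqrt M > 0" using assms(2,3) by simp
  have g1: "w\<^sup>2 \<le> 2 * l * r" and f1: "2/3 * l * r\<^sup>2 \<le> \<Delta>"
    using acc by (auto simp: accepted_def Let_def xp l_def r_def w2 \<Delta>_def)
  have "0 \<le> 2/3 * l * r\<^sup>2" using l0 by simp
  with f1 have \<Delta>0: "0 \<le> \<Delta>" by linarith
  have "h * norm (g x) \<le> M * (4 * norm (g xp))"
    using assms(2,3) good by (intro mult_mono) auto
  then have "l \<le> sqrt (M * (4 * norm (g xp)))"
    by (simp add: l_def reg_param_def)
  also have "\<dots> = 2 * sqrt M * w"
    by (simp add: real_sqrt_mult w_def)
  finally have l_le: "l \<le> 2 * sqrt M * w" .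
  have "w * w ^ 3 = (w\<^sup>2)\<^sup>2" by (simp add: power2_eq_square power3_eq_cube)
  also have "\<dots> \<le> (2 * l * r)\<^sup>2"
    using g1 by (intro power_mono) auto
  also have "\<dots> = 6 * l * (2/3 * l * r\<^sup>2)" by (simp add: power2_eq_square)
  also have "\<dots> \<le> 6 * l * \<Delta>" using f1 l0 by (intro mult_left_mono) auto
  also have "\<dots> \<le> 6 * (2 * sqrt M * w) * \<Delta>"
    using l_le \<Delta>0 by (intro mult_right_mono mult_left_mono) simp_all
  finally have "w * w ^ 3 \<le> w * (12 * sqrt M * \<Delta>)" by (simp add: mult_ac)
  then have w3: "w ^ 3 \<le> 12 * sqrt M * \<Delta>"
    using w0 \<Delta>0 sM by (cases "w = 0") (auto simp: mult_le_cancel_left)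
  have "sqrt (f xp - fs) \<le> sqrt D * w"
    using gap by (simp add: w_def flip: real_sqrt_mult)
  then have "sqrt (f xp - fs) ^ 3 \<le> (sqrt D * w) ^ 3"
    using gap by (intro power_mono) auto
  also have "\<dots> = sqrt D ^ 3 * w ^ 3" by (rule power_mult_distrib)
  also have "\<dots> \<le> sqrt D ^ 3 * (12 * sqrt M * \<Delta>)"
    using w3 assms(4) by (intro mult_left_mono) auto
  finally have "sqrt (f xp - fs) ^ 3 \<le> \<Delta> * (12 * sqrt M * sqrt D ^ 3)"
    by (simp add: mult_ac)
  moreover have "0 < 12 * sqrt M * sqrt D ^ 3" using sM assms(4) by simp
  ultimately have "sqrt (f xp - fs) ^ 3 / (12 * sqrt M * sqrt D ^ 3) \<le> \<Delta>"
    by (simp add: pos_divide_le_eq)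
  then show ?thesis by (simp add: \<Delta>_def)
qed

text \<open>The first conjunct determines the three sequences and includes termination of every line
  search. The estimate with index \<open>k - 1\<close> is \<open>hprev k\<close>, so that
  \<open>hprev 0\<close> is \<open>H0\<close>.\<close>

theorem theorem3:
  fixes f :: "real^'d \<Rightarrow> real" and g :: "real^'d \<Rightarrow> real^'d" and A :: "real^'d \<Rightarrow> real^'d^'d"
    and x0 xstar :: "real^'d" and fstar H H0 D :: real
  assumes convex: "convex_on UNIV f"
    and gradient: "\<And>x. GDERIV f x :> g x"
    and hessian: "\<And>x. (g has_derivative (\<lambda>v. A x *v v)) (at x)"
    and H_pos: "H > 0"
    and cubic_bound: "\<And>x y. f y \<le> f x + g x \<bullet> (y - x) + 1/2 * ((A x *v (y - x)) \<bullet> (y - x))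
                          + H/3 * norm (y - x) ^ 3"
    and gradient_bound: "\<And>x y. norm (g y - g x - A x *v (y - x)) \<le> H * (norm (x - y))\<^sup>2"
    and H0_pos: "H0 > 0"
    and fstar_attained: "f xstar = fstar"
    and fstar_min: "\<And>x. fstar \<le> f x"
    and D_pos: "D > 0"
    and sublevel_bound: "\<And>x. f x \<le> f x0 \<Longrightarrow> norm (x - xstar) \<le> D"
    and well_defined: "\<And>k x hp h n. adan f g A x0 H0 k = Some (x, hp) \<Longrightarrow>
          (h, n) \<in> inner_passes f g A x hp \<Longrightarrow> invertible (reg_hessian g A h x)"
  shows "\<exists>(x :: nat \<Rightarrow> real^'d) (hprev :: nat \<Rightarrow> real) (n :: nat \<Rightarrow> nat).
     (\<forall>k. adan f g A x0 H0 k = Some (x k, hprev k) \<and>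
          line_search f g A (x k) (hprev k) = Some (hprev (Suc k), n k)) \<and>
     (\<forall>k. real (\<Sum>i\<le>k. n i) \<le> 2 * (real k + 1) + max 0 (log 2 (2 * H / H0))) \<and>
     (\<exists>C. \<forall>k\<ge>1. f (x k) - fstar \<le> C / (real k)\<^sup>2) \<and>
     (\<exists>C'. \<forall>k\<ge>1. f (x k) - fstar \<le> C' / (real (\<Sum>i\<le>k. n i))\<^sup>2)"
proof -

  \<comment> \<open>Existence of the infinite run\<close>
  have psd: "0 \<le> (A x *v v) \<bullet> v" for x v
    using hessian by (rule monotone_derivative_nonneg) (rule convex_gradient_monotone[OF convex gradient])
  \<comment> \<open>Restricted to states that the run reaches, since only there are the regularized
    Hessians known to be invertible.\<close>
  have step: "\<exists>n. line_search f g A x hp = Some (hp / 4 * 2 ^ n, n) \<and> 1 \<le> n \<and>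
      hp / 4 * 2 ^ n \<le> max hp (2 * H)" if "adan f g A x0 H0 k = Some (x, hp)" "hp > 0" for k x hp
  proof -
    have "accepted f g A x h" if "(h, n) \<in> inner_passes f g A x hp" "H \<le> h" for h n
      using H_pos that(2) well_defined[OF \<open>adan f g A x0 H0 k = Some (x, hp)\<close> that(1)]
        psd cubic_bound gradient_bound
      by (rule accepted_if_estimate_ge)
    then show ?thesis
      by (rule line_search_terminates[where f = f and g = g and A = A and x = x, OF H_pos \<open>hp > 0\<close>]) blast+
  qed
  have run: "\<exists>x hp. adan f g A x0 H0 k = Some (x, hp) \<and> 0 < hp" for k
  proof (induction k)
    case (Suc k)
    then obtain x hp where "adan f g A x0 H0 k = Some (x, hp)" "0 < hp" by blast
    with step[OF this] show ?case by auto
  qed (use H0_pos in simp)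
  define x where "x k = fst (the (adan f g A x0 H0 k))" for k
  define hprev where "hprev k = snd (the (adan f g A x0 H0 k))" for k
  define n where "n k = snd (the (line_search f g A (x k) (hprev k)))" for k
  have adan: "adan f g A x0 H0 k = Some (x k, hprev k)" and hpos: "0 < hprev k" for k
    using run[of k] by (auto simp: x_def hprev_def)
  have ls: "line_search f g A (x k) (hprev k) = Some (hprev k / 4 * 2 ^ n k, n k)"
    and n1: "1 \<le> n k" and hmax: "hprev k / 4 * 2 ^ n k \<le> max (hprev k) (2 * H)" for k
    using step[OF adan hpos, of k] by (auto simp: n_def)
  have x_Suc: "x (Suc k) = newton_step g A (hprev (Suc k)) (x k)"
    and h_Suc: "hprev (Suc k) = hprev k / 4 * 2 ^ n k" for k
    using adan[of "Suc k"] by (auto simp: adan[of k] ls)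
  have ls': "line_search f g A (x k) (hprev k) = Some (hprev (Suc k), n k)" for k
    by (simp add: ls h_Suc)
  have x_0: "x 0 = x0" and h_0: "hprev 0 = H0"
    by (simp_all add: x_def hprev_def)
  have pass: "(hprev (Suc k), n k) \<in> inner_passes f g A (x k) (hprev k)"
    and acc: "accepted f g A (x k) (hprev (Suc k))" for k
    using ls'[of k] by (auto simp: line_search_eq_Some_iff)

  \<comment> \<open>The number of Newton steps\<close>
  define M where "M = max H0 (2 * H)"
  have h_le: "hprev k \<le> M" for k
  proof (induction k)
    case (Suc k)
    then show ?case using hmax[of k] by (auto simp: h_Suc M_def)
  qed (simp add: h_0 M_def)
  define L where "L = max 0 (log 2 (2 * H / H0))"
  \<comment> \<open>The last estimate records the total number of passes, which a logarithm
    recovers.\<close>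
  have h_prod: "hprev (Suc k) = H0 * 2 ^ (\<Sum>i\<le>k. n i) / 4 ^ Suc k" for k
    by (induction k) (simp_all add: h_Suc h_0 power_add)
  have count: "real (\<Sum>i\<le>k. n i) \<le> 2 * (real k + 1) + L" for k
  proof -
    define N where "N = (\<Sum>i\<le>k. n i)"
    have "(2::real) ^ N = hprev (Suc k) / H0 * 4 ^ Suc k"
      using H0_pos by (simp add: h_prod N_def)
    also have "(4::real) ^ Suc k = 2 ^ (2 * Suc k)" by (simp only: power_mult) simp
    finally have "log 2 (2 ^ N) = log 2 (hprev (Suc k) / H0 * 2 ^ (2 * Suc k))" by simp
    also have "\<dots> = log 2 (hprev (Suc k) / H0) + log 2 (2 ^ (2 * Suc k))"
      using H0_pos hpos[of "Suc k"] by (intro log_mult_pos) auto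
    finally have "real N = log 2 (hprev (Suc k) / H0) + real (2 * Suc k)"
      by (simp only: log_pow_cancel)
    \<comment> \<open>An estimate up to \<open>H0\<close> contributes a nonpositive logarithm,
      whence the maximum with 0; one above \<open>H0\<close> can be bounded by \<open>M\<close> only
      through \<open>2 * H\<close>.\<close>
    moreover have "log 2 (hprev (Suc k) / H0) \<le> L"
    proof (cases "hprev (Suc k) \<le> H0")
      case True
      then have "log 2 (hprev (Suc k) / H0) \<le> 0"
        using H0_pos hpos[of "Suc k"] by (subst log_le_zero_cancel_iff) auto
      then show ?thesis by (simp add: L_def)
    next
      case False
      then have "hprev (Suc k) \<le> 2 * H" using h_le[of "Suc k"] by (auto simp: M_def)
      then have "log 2 (hprev (Suc k) / H0) \<le> log 2 (2 * H / H0)"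
        using H0_pos H_pos hpos[of "Suc k"] by (subst log_le_cancel_iff) (auto simp: divide_right_mono)
      then show ?thesis by (simp add: L_def)
    qed
    ultimately show ?thesis by (simp add: N_def)
  qed

  \<comment> \<open>The convergence rates in \<open>k\<close> and in the number of Newton
    steps\<close>
  define a where "a k = f (x k) - fstar" for k
  define G where "G k = norm (g (x k))" for k
  define r where "r k = norm (x (Suc k) - x k)" for k
  define l where "l k = reg_param g (hprev (Suc k)) (x k)" for k
  have l0: "0 \<le> l k" for k using hpos[of "Suc k"] by (simp add: l_def reg_param_def)
  have G_Suc: "G (Suc k) \<le> 2 * l k * r k"
    and f_Suc: "f (x (Suc k)) \<le> f (x k) - 2/3 * l k * (r k)\<^sup>2" for k
    using acc[of k] by (auto simp: accepted_def Let_def G_def l_def r_def x_Suc)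
  have f_mono: "f (x (Suc k)) \<le> f (x k)" for k
    using f_Suc[of k] l0[of k] by (smt (verit) mult_nonneg_nonneg zero_le_power2 divide_nonneg_nonneg)
  have "f (x k) \<le> f x0" for k
    by (induction k) (auto simp: x_0 intro: order_trans[OF f_mono])
  then have dist: "norm (x k - xstar) \<le> D" for k by (rule sublevel_bound)
  have aG: "a k \<le> D * G k" for k
  proof -
    have "a k \<le> g (x k) \<bullet> (x k - xstar)"
      using convex_on_above_gradient[OF convex gradient, of "x k" xstar]
      by (simp add: a_def fstar_attained inner_diff_right)
    also have "\<dots> \<le> norm (g (x k)) * norm (x k - xstar)" by (rule norm_cauchy_schwarz)
    also have "\<dots> \<le> D * G k"
      using mult_left_mono[OF dist, of "norm (g (x k))" k] by (simp add: G_def mult.commute)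
    finally show ?thesis .
  qed
  have a0: "0 \<le> a k" for k using fstar_min by (simp add: a_def)
  have lr: "l k * r k \<le> G k" for k
    using newton_step_displacement[OF hpos well_defined[OF adan pass] psd]
    by (simp add: l_def r_def G_def x_Suc)
  have G_double: "G (Suc k) \<le> 2 * G k" for k
    using G_Suc[of k] lr[of k] by linarith
  define c where "c = 1 / (12 * sqrt M * sqrt D ^ 3)"
  have "c > 0" using H_pos D_pos by (simp add: c_def M_def less_max_iff_disj)
  have dec: "a (Suc k) + c * sqrt (a (Suc k)) ^ 3 \<le> a k" if "G k / 4 \<le> G (Suc k)" for k
    using accepted_decrease[OF acc hpos h_le D_pos x_Suc] that a0[of "Suc k"] aG[of "Suc k"]
    by (simp add: a_def G_def c_def)
  obtain C where C: "0 \<le> C" "\<And>k. 1 \<le> k \<Longrightarrow> a k \<le> C / (real k)\<^sup>2"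
    using inverse_square_rate[where a = a and G = G, OF \<open>c > 0\<close> D_pos a0 aG _ G_double dec] f_mono
    by (auto simp: a_def)
  have rate_N: "a k \<le> C * (4 + L)\<^sup>2 / (real (\<Sum>i\<le>k. n i))\<^sup>2" if "1 \<le> k" for k
  proof -
    define N where "N = real (\<Sum>i\<le>k. n i)"
    have "n 0 \<le> (\<Sum>i\<le>k. n i)" by (rule member_le_sum) auto
    then have N0: "0 < N" using n1[of 0] by (simp add: N_def del: of_nat_sum)
    \<comment> \<open>For \<open>k \<ge> 1\<close> the additive terms are absorbed,
      \<open>2 * (k + 1) + L \<le> (4 + L) * k\<close>, which is the source of the factor
      \<open>(4 + L)\<^sup>2\<close>.\<close>
    have "L \<le> L * real k" using that by (simp add: L_def mult_le_cancel_left1)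
    then have "N \<le> (4 + L) * real k"
      using count[of k] that unfolding N_def by (simp add: algebra_simps)
    then have "N\<^sup>2 \<le> (4 + L)\<^sup>2 * (real k)\<^sup>2"
      using N0 power_mono[of N "(4 + L) * real k" 2] by (simp add: power_mult_distrib)
    then have "C * N\<^sup>2 \<le> C * ((4 + L)\<^sup>2 * (real k)\<^sup>2)"
      using C(1) by (rule mult_left_mono)
    then have "C / (real k)\<^sup>2 \<le> C * (4 + L)\<^sup>2 / N\<^sup>2"
      using N0 that by (simp add: divide_simps mult_ac)
    with C(2)[OF that] show ?thesis by (simp add: N_def)
  qed
  show ?thesis
  proof (intro exI conjI allI impI)
    show "adan f g A x0 H0 k = Some (x k, hprev k)" for k by (rule adan)
    show "line_search f g A (x k) (hprev k) = Some (hprev (Suc k), n k)" for k by (rule ls')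
    show "real (\<Sum>i\<le>k. n i) \<le> 2 * (real k + 1) + max 0 (log 2 (2 * H / H0))" for k
      using count by (simp add: L_def)
    show "f (x k) - fstar \<le> C / (real k)\<^sup>2" if "1 \<le> k" for k
      using C(2)[OF that] by (simp add: a_def)
    show "f (x k) - fstar \<le> C * (4 + L)\<^sup>2 / (real (\<Sum>i\<le>k. n i))\<^sup>2" if "1 \<le> k" for k
      using rate_N[OF that] by (simp add: a_def)
  qed
qed

end
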